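(* Let $n\ge 1$ be an integer, let $\alpha,b>0$, $\delta\in(0,1)$, $0<a_0\le a_1$ be real numbers, and let $\tau_0,\tau_1\ge 0$ be integers and $\tau_2=0$. Consider the delayed discrete-time system $$\begin{cases} q_0(t+1)=q_0(t)+\alpha q_0(t)\Big[a_0-bq_0(t)-b\delta\sum_{i=1}^n q_i(t-\tau_1)\Big],\\[2pt] q_j(t+1)=\dfrac{a_1}{2b}-\dfrac{\delta}{2}q_0(t-\tau_0)-\dfrac{\delta}{2}\sum_{i=1,\,i\ne j}^n q_i(t-\tau_2),\quad j=1,\dots,n.\end{cases}$$ Assume that $$[2+(n-1)\delta]\,a_0>n\delta a_1\qquad\text{and}\qquad a_1>\delta a_0,$$ and let $E_+=(q_0^\star,q_1^\star,\dots,q_1^\star)\in\mathbb{R}^{n+1}$ be the positive equilibrium, where $$q_0^\star=\frac{[2+(n-1)\delta]a_0-n\delta a_1}{b[2+(n-1)\delta-n\delta^2]},\qquad q_1^\star=\frac{a_1-\delta a_0}{b[2+(n-1)\delta-n\delta^2]}.$$ Set $$\varepsilon_0=\frac{n\delta^2}{2},\qquad \varepsilon_1=\alpha\,\frac{[2+(n-1)\delta]a_0-n\delta a_1}{2+(n-1)\delta-n\delta^2}-1,\qquad \varepsilon_2=\frac{(n-1)\delta}{2}.$$ If $$\varepsilon_2<1\qquad\text{and}\qquad \varepsilon_1<\frac{1-\varepsilon_2-\varepsilon_0}{1-\varepsilon_2+\varepsilon_0},$$ then the equilibrium point $E_+$ is asymptotically stable.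
   Context: Let $\tau=\max\{\tau_0,\tau_1,\tau_2\}$. The delayed system is identified with the (delay-free) map $F$ on $\mathbb{R}^{(n+1)(\tau+1)}$ that sends the history $(q(t),q(t-1),\dots,q(t-\tau))$, with $q=(q_0,\dots,q_n)$, to $(q(t+1),q(t),\dots,q(t-\tau+1))$. An equilibrium $E\in\mathbb{R}^{n+1}$ corresponds to the fixed point $(E,\dots,E)$ of $F$. "Asymptotically stable" means locally asymptotically stable: the fixed point $(E,\dots,E)$ is Lyapunov stable under iteration of $F$, and all orbits starting sufficiently close to it converge to it. *)

theory Defs
  imports "HOL-Analysis.L2_Norm" "HOL-Library.FuncSet"
begin

section \<open>Stability of fixed points\<close>

text \<open>The state space is an explicit set \<open>X\<close> with distance function \<open>d\<close>, because its dimension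
  below depends on natural-number parameters.\<close>

definition lyapunov_stable ::
  "'a set \<Rightarrow> ('a \<Rightarrow> 'a \<Rightarrow> real) \<Rightarrow> ('a \<Rightarrow> 'a) \<Rightarrow> 'a \<Rightarrow> bool" where
  "lyapunov_stable X d F p \<longleftrightarrow>
    (\<forall>e>0. \<exists>r>0. \<forall>x\<in>X. d x p < r \<longrightarrow> (\<forall>t. d ((F ^^ t) x) p < e))"

definition locally_attractive ::
  "'a set \<Rightarrow> ('a \<Rightarrow> 'a \<Rightarrow> real) \<Rightarrow> ('a \<Rightarrow> 'a) \<Rightarrow> 'a \<Rightarrow> bool" where
  "locally_attractive X d F p \<longleftrightarrow>
    (\<exists>r>0. \<forall>x\<in>X. d x p < r \<longrightarrow> (\<lambda>t. d ((F ^^ t) x) p) \<longlonglongrightarrow> 0)"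

definition asymptotically_stable_fixpoint ::
  "'a set \<Rightarrow> ('a \<Rightarrow> 'a \<Rightarrow> real) \<Rightarrow> ('a \<Rightarrow> 'a) \<Rightarrow> 'a \<Rightarrow> bool" where
  "asymptotically_stable_fixpoint X d F p \<longleftrightarrow>
    p \<in> X \<and> F p = p \<and> lyapunov_stable X d F p \<and> locally_attractive X d F p"

section \<open>Delayed systems as maps on histories\<close>

text \<open>The history \<open>(q(t), q(t-1), \<dots>, q(t-\<tau>))\<close> with \<open>q = (q\<^sub>0, \<dots>, q\<^sub>n)\<close> is the function
  \<open>h\<close> on \<open>{..\<tau>} \<times> {..n}\<close> with \<open>h (s, i) = q\<^sub>i(t-s)\<close>; thus \<open>histories n \<tau>\<close> with
  \<open>history_dist n \<tau>\<close> is the Euclidean space of dimension \<open>(n+1)(\<tau>+1)\<close>.\<close>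

type_synonym history = "nat \<times> nat \<Rightarrow> real"

definition histories :: "nat \<Rightarrow> nat \<Rightarrow> history set" where
  "histories n \<tau> = ({..\<tau>} \<times> {..n}) \<rightarrow>\<^sub>E UNIV"

definition history_dist :: "nat \<Rightarrow> nat \<Rightarrow> history \<Rightarrow> history \<Rightarrow> real" where
  "history_dist n \<tau> g h = L2_set (\<lambda>k. g k - h k) ({..\<tau>} \<times> {..n})"

text \<open>\<open>f h i\<close> is the new value \<open>q\<^sub>i(t+1)\<close> computed from the history \<open>h\<close> at time \<open>t\<close>.\<close>

definition history_map :: "nat \<Rightarrow> nat \<Rightarrow> (history \<Rightarrow> nat \<Rightarrow> real) \<Rightarrow> history \<Rightarrow> history" where
  "history_map n \<tau> f h =
    (\<lambda>(s, i) \<in> {..\<tau>} \<times> {..n}. if s = 0 then f h i else h (s - 1, i))"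

definition constant_history :: "nat \<Rightarrow> nat \<Rightarrow> (nat \<Rightarrow> real) \<Rightarrow> history" where
  "constant_history n \<tau> E = (\<lambda>(s, i) \<in> {..\<tau>} \<times> {..n}. E i)"

definition asymptotically_stable_equilibrium ::
  "nat \<Rightarrow> nat \<Rightarrow> (history \<Rightarrow> nat \<Rightarrow> real) \<Rightarrow> (nat \<Rightarrow> real) \<Rightarrow> bool" where
  "asymptotically_stable_equilibrium n \<tau> f E \<longleftrightarrow>
    asymptotically_stable_fixpoint (histories n \<tau>) (history_dist n \<tau>)
      (history_map n \<tau> f) (constant_history n \<tau> E)"

section \<open>The oligopoly system\<close>

definition oligopoly_step ::
  "nat \<Rightarrow> real \<Rightarrow> real \<Rightarrow> real \<Rightarrow> real \<Rightarrow> real \<Rightarrow> nat \<Rightarrow> nat \<Rightarrow> nat \<Rightarrow> history \<Rightarrow> nat \<Rightarrow> real"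
  where
  "oligopoly_step n \<alpha> b \<delta> a0 a1 \<tau>0 \<tau>1 \<tau>2 h j =
    (if j = 0
     then h (0, 0) + \<alpha> * h (0, 0) * (a0 - b * h (0, 0) - b * \<delta> * (\<Sum>i = 1..n. h (\<tau>1, i)))
     else a1 / (2 * b) - \<delta> / 2 * h (\<tau>0, 0) - \<delta> / 2 * (\<Sum>i \<in> {1..n} - {j}. h (\<tau>2, i)))"

end

theory Submission
  imports Defs "HOL-Computational_Algebra.Fundamental_Theorem_Algebra"
begin

text \<open>Stability is decided by the linearization: if every orbit of the linear part \<open>A\<close> tends
  to \<open>0\<close>, then some power \<open>A\<^sup>K\<close> is a contraction by \<open>1/2\<close>, and \<open>V z = (\<Sum>t<K. \<parallel>A\<^sup>t z\<parallel>)\<close> is a norm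
  that strictly decreases along \<open>A\<close>, hence along the nonlinear map near the fixed point.

  In the linearized oligopoly, eliminating the sum of the \<open>q\<^sub>j\<close> leaves for the deviation of \<open>q\<^sub>0\<close>
  the scalar recurrence with characteristic equation
  \<open>(z + \<epsilon>\<^sub>1) (z + \<epsilon>\<^sub>2) z\<^bsup>\<tau>\<^sub>0 + \<tau>\<^sub>1\<^esup> = (1 + \<epsilon>\<^sub>1) \<epsilon>\<^sub>0\<close>. On a circle \<open>|z| = r \<ge> 1\<close> the modulus of the
  left-hand side is smallest at \<open>z = r\<close> or \<open>z = - r\<close>, where the hypotheses keep it above
  the right-hand side; so all roots lie in the open unit disc.\<close>

section \<open>Scalar linear recurrences\<close>

text \<open>The initial value is damped geometrically, and an input that is eventually below
  \<open>\<eta>\<close> accumulates to at most \<open>\<eta> / (1 - norm c)\<close>.\<close>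

lemma first_order_recurrence_tendsto_0:
  fixes v :: "nat \<Rightarrow> 'a::real_normed_field"
  assumes c: "norm c < 1" and lim: "(\<lambda>t. v (Suc t) - c * v t) \<longlonglongrightarrow> 0"
  shows "v \<longlonglongrightarrow> 0"
proof (rule LIMSEQ_I)
  fix e :: real assume e: "e > 0"
  \<comment> \<open>With this value \<open>e / 2\<close> is the fixed point of
    \<open>x \<mapsto> \<eta> + norm c * x\<close>, so the bound below reproduces itself.\<close>
  define \<eta> where "\<eta> = e / 2 * (1 - norm c)"
  have "\<eta> > 0" using e c by (simp add: \<eta>_def)
  with LIMSEQ_D[OF lim] obtain N where N: "\<And>t. t \<ge> N \<Longrightarrow> norm (v (Suc t) - c * v t) < \<eta>"
    by (metis diff_zero)
  have bound: "norm (v (k + N)) \<le> norm c ^ k * norm (v N) + e / 2" for k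
  proof (induction k)
    case (Suc k)
    have "norm (v (Suc k + N)) = norm ((v (Suc (k + N)) - c * v (k + N)) + c * v (k + N))" by simp
    also have "\<dots> \<le> \<eta> + norm c * norm (v (k + N))"
      by (metis N add_mono_thms_linordered_semiring(3) le_add2 less_imp_le norm_mult norm_triangle_mono order_refl)
    also have "\<dots> \<le> \<eta> + norm c * (norm c ^ k * norm (v N) + e / 2)"
      using Suc by (intro add_left_mono mult_left_mono) auto
    also have "\<dots> = norm c ^ Suc k * norm (v N) + e / 2"
      by (simp add: \<eta>_def field_simps)
    finally show ?case .
  qed (use e in simp)
  have "(\<lambda>k. norm c ^ k * norm (v N)) \<longlonglongrightarrow> 0"
    using c by (intro tendsto_mult_left_zero LIMSEQ_realpow_zero) auto
  then obtain k0 where k0: "\<And>k. k \<ge> k0 \<Longrightarrow> norm (norm c ^ k * norm (v N) - 0) < e / 2"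
    using e by (meson LIMSEQ_D half_gt_zero)
  have "norm (v t - 0) < e" if "t \<ge> k0 + N" for t
  proof -
    have "norm (v t) \<le> norm c ^ (t - N) * norm (v N) + e / 2" using bound[of "t - N"] that by simp
    moreover have "norm c ^ (t - N) * norm (v N) < e / 2" using k0[of "t - N"] that by simp
    ultimately show ?thesis by simp
  qed
  then show "\<exists>no. \<forall>t\<ge>no. norm (v t - 0) < e" by blast
qed

text \<open>This is \<open>p\<close> evaluated at the forward shift operator and applied to
  \<open>u\<close>; products of polynomials act as compositions.\<close>

definition poly_shift :: "complex poly \<Rightarrow> (nat \<Rightarrow> complex) \<Rightarrow> nat \<Rightarrow> complex" where
  "poly_shift p u t = (\<Sum>k\<le>degree p. coeff p k * u (t + k))"

lemma poly_shift_eq: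
  assumes "degree p \<le> N"
  shows "poly_shift p u t = (\<Sum>k\<le>N. coeff p k * u (t + k))"
  unfolding poly_shift_def
  using assms by (intro sum.mono_neutral_left) (auto simp: coeff_eq_0)

lemma poly_shift_add: "poly_shift (p + q) u t = poly_shift p u t + poly_shift q u t"
proof -
  let ?N = "max (degree p) (degree q)"
  have "degree (p + q) \<le> ?N" by (rule degree_add_le_max)
  then show ?thesis
    by (simp add: poly_shift_eq[of _ ?N] sum.distrib algebra_simps)
qed

lemma poly_shift_smult: "poly_shift (smult c p) u t = c * poly_shift p u t"
  by (simp add: poly_shift_eq[of _ "degree p"] degree_smult_le sum_distrib_left mult.assoc
      del: degree_smult_eq)

lemma poly_shift_pCons: "poly_shift (pCons a p) u t = a * u t + poly_shift p u (Suc t)"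
proof -
  have "poly_shift (pCons a p) u t = (\<Sum>k\<le>Suc (degree p). coeff (pCons a p) k * u (t + k))"
    by (intro poly_shift_eq degree_pCons_le)
  then show ?thesis
    by (simp add: poly_shift_def sum.atMost_Suc_shift del: sum.atMost_Suc)
qed

lemma poly_shift_linear_factor:
  "poly_shift ([:a, 1:] * q) u t = a * poly_shift q u t + poly_shift q u (Suc t)"
  by (simp add: poly_shift_add poly_shift_smult poly_shift_pCons)

lemma poly_shift_monom: "poly_shift (monom 1 m) u t = u (t + m)"
  by (induction m arbitrary: t) (simp_all add: monom_0 monom_Suc poly_shift_pCons, simp add: poly_shift_def)

lemma poly_shift_const: "poly_shift [:a:] u t = a * u t"
  by (simp add: poly_shift_def)

text \<open>Roots are split off one at a time: if \<open>p = [:- z, 1:] * q\<close>, then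
  \<open>poly_shift q u\<close> obeys a first-order recurrence with multiplier \<open>z\<close> and
  vanishing input. Asking only for \<open>poly_shift p u\<close> to tend to 0, not to equal 0, is
  what lets the induction pass from \<open>p\<close> to \<open>q\<close>.\<close>

lemma recurrence_tendsto_0:
  assumes "\<And>z. poly p z = 0 \<Longrightarrow> norm z < 1" and "poly_shift p u \<longlonglongrightarrow> 0"
  shows "u \<longlonglongrightarrow> 0"
  using assms
proof (induction "degree p" arbitrary: p)
  case 0
  then obtain a where a: "p = [:a:]" by (metis degree_eq_zeroE)
  \<comment> \<open>The zero polynomial would have the root 1, which is not inside the unit
    disc.\<close>
  with "0.prems"(1)[of 1] have "a \<noteq> 0" by auto
  have "(\<lambda>t. inverse a * poly_shift p u t) \<longlonglongrightarrow> inverse a * 0"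
    by (intro tendsto_intros 0)
  with \<open>a \<noteq> 0\<close> show ?case by (simp add: a poly_shift_const flip: mult.assoc)
next
  case (Suc d)
  then have "\<not> constant (poly p)" by (simp add: constant_degree)
  then obtain z where z: "poly p z = 0" using fundamental_theorem_of_algebra by blast
  then obtain q where q: "p = [:- z, 1:] * q" by (metis dvdE poly_eq_0_iff_dvd)
  have "p \<noteq> 0" using Suc.hyps(2) by auto
  then have "q \<noteq> 0" using q by auto
  then have "degree p = Suc (degree q)" by (simp add: q degree_mult_eq del: mult_pCons_left)
  with Suc.hyps(2) have "d = degree q" by simp
  moreover have "poly_shift q u \<longlonglongrightarrow> 0"
  proof (rule first_order_recurrence_tendsto_0)
    show "norm z < 1" using Suc.prems(1) z by blast
    show "(\<lambda>t. poly_shift q u (Suc t) - z * poly_shift q u t) \<longlonglongrightarrow> 0"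
    proof -
      have "poly_shift p u = (\<lambda>t. poly_shift q u (Suc t) - z * poly_shift q u t)"
        by (rule ext) (simp only: q poly_shift_linear_factor, simp)
      then show ?thesis using Suc.prems(2) by simp
    qed
  qed
  ultimately show ?case using Suc.hyps(1)[of q] Suc.prems(1) by (simp add: q)
qed

section \<open>Stability by linearization\<close>

text \<open>Displacements are total functions, so that they add and scale pointwise. The difference
  of two extensional functions on \<open>I\<close> is 0 outside \<open>I\<close>, and
  \<open>support\<close> gives images under \<open>A\<close> the same form.\<close>

locale linear_coordinate_map =
  fixes I :: "'i set" and A :: "('i \<Rightarrow> real) \<Rightarrow> 'i \<Rightarrow> real"
  assumes finite_index: "finite I"
    and add: "A (\<lambda>k. x k + y k) = (\<lambda>k. A x k + A y k)"
    and scale: "A (\<lambda>k. c * x k) = (\<lambda>k. c * A x k)"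
    and support: "k \<notin> I \<Longrightarrow> A x k = 0"
begin

lemma funpow_add: "(A ^^ t) (\<lambda>k. x k + y k) = (\<lambda>k. (A ^^ t) x k + (A ^^ t) y k)"
  by (induction t) (simp_all add: add)

lemma funpow_scale: "(A ^^ t) (\<lambda>k. c * x k) = (\<lambda>k. c * (A ^^ t) x k)"
  by (induction t) (simp_all add: scale)

lemma funpow_sum:
  "finite J \<Longrightarrow> (A ^^ t) (\<lambda>k. \<Sum>l\<in>J. c l * e l k) = (\<lambda>k. \<Sum>l\<in>J. c l * (A ^^ t) (e l) k)"
proof (induction J rule: finite_induct)
  case empty
  show ?case using funpow_scale[of t 0 "\<lambda>_. 0"] by simp
next
  case (insert l J)
  then show ?case by (simp add: funpow_add funpow_scale)
qed

text \<open>Expanding \<open>x\<close> in unit vectors bounds the operator norm of the power by the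
  sum of the absolute values of its matrix entries. Each entry is a coordinate of an orbit of
  \<open>A\<close>, so coordinatewise decay of orbits becomes decay of this bound.\<close>

lemma funpow_bound:
  assumes "\<And>k. k \<notin> I \<Longrightarrow> x k = 0"
  shows "L2_set ((A ^^ t) x) I
    \<le> (\<Sum>k\<in>I. \<Sum>l\<in>I. \<bar>(A ^^ t) (\<lambda>m. if m = l then 1 else 0) k\<bar>) * L2_set x I"
proof -
  let ?e = "\<lambda>l m. if m = l then 1 else 0 :: real"
  have "x k = (\<Sum>l\<in>I. x l * ?e l k)" for k
    using finite_index assms[of k] by (cases "k \<in> I") (simp_all add: if_distrib sum.delta cong: if_cong)
  then have x: "x = (\<lambda>k. \<Sum>l\<in>I. x l * ?e l k)" by blast
  have "L2_set ((A ^^ t) x) I \<le> (\<Sum>k\<in>I. \<bar>(A ^^ t) x k\<bar>)"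
    by (rule L2_set_le_sum_abs)
  also have "\<dots> = (\<Sum>k\<in>I. \<bar>\<Sum>l\<in>I. x l * (A ^^ t) (?e l) k\<bar>)"
    by (subst x) (simp only: funpow_sum[OF finite_index])
  also have "\<dots> \<le> (\<Sum>k\<in>I. \<Sum>l\<in>I. \<bar>x l * (A ^^ t) (?e l) k\<bar>)"
    by (intro sum_mono sum_abs)
  also have "\<dots> \<le> (\<Sum>k\<in>I. \<Sum>l\<in>I. \<bar>(A ^^ t) (?e l) k\<bar> * L2_set x I)"
  proof (intro sum_mono)
    fix k l assume "l \<in> I"
    then have "\<bar>x l\<bar> \<le> L2_set (\<lambda>i. \<bar>x i\<bar>) I" by (intro member_le_L2_set finite_index)
    then have "\<bar>x l\<bar> \<le> L2_set x I" by (simp add: L2_set_def)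
    then show "\<bar>x l * (A ^^ t) (?e l) k\<bar> \<le> \<bar>(A ^^ t) (?e l) k\<bar> * L2_set x I"
      by (simp add: abs_mult mult.commute[of "\<bar>x l\<bar>"] mult_left_mono)
  qed
  finally show ?thesis by (simp add: sum_distrib_right)
qed

text \<open>Since \<open>F p = p\<close>, the last hypothesis is differentiability of
  \<open>F\<close> at \<open>p\<close> with derivative \<open>A\<close>.\<close>

theorem asymptotically_stable_by_linearization:
  assumes p: "p \<in> I \<rightarrow>\<^sub>E UNIV" "F p = p"
    and F: "\<And>x. x \<in> I \<rightarrow>\<^sub>E UNIV \<Longrightarrow> F x \<in> I \<rightarrow>\<^sub>E UNIV"
    and lim: "\<And>x k. k \<in> I \<Longrightarrow> (\<lambda>t. (A ^^ t) x k) \<longlonglongrightarrow> 0"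
    and remainder: "\<And>\<eta>. \<eta> > 0 \<Longrightarrow> \<exists>r>0. \<forall>x \<in> I \<rightarrow>\<^sub>E UNIV. L2_set (\<lambda>k. x k - p k) I < r \<longrightarrow>
      L2_set (\<lambda>k. F x k - p k - A (\<lambda>k. x k - p k) k) I \<le> \<eta> * L2_set (\<lambda>k. x k - p k) I"
  shows "asymptotically_stable_fixpoint (I \<rightarrow>\<^sub>E UNIV) (\<lambda>x y. L2_set (\<lambda>k. x k - y k) I) F p"
proof -
  let ?X = "I \<rightarrow>\<^sub>E (UNIV :: real set)"

  \<comment> \<open>A norm adapted to the linear part\<close>
  define c where "c t = (\<Sum>k\<in>I. \<Sum>l\<in>I. \<bar>(A ^^ t) (\<lambda>m. if m = l then 1 else 0) k\<bar>)" for t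
  define N where "N x = L2_set x I" for x
  have N0: "N x \<ge> 0" for x by (simp add: N_def)
  have bound: "N ((A ^^ t) x) \<le> c t * N x" if "\<And>k. k \<notin> I \<Longrightarrow> x k = 0" for t x
    unfolding N_def c_def using funpow_bound[OF that] .
  have "c \<longlonglongrightarrow> 0" unfolding c_def
    by (intro tendsto_null_sum tendsto_rabs_zero lim)
  then have "\<forall>\<^sub>F t in sequentially. c t < 1/2" by (rule order_tendstoD) simp
  then obtain K0 where K0: "\<And>t. t \<ge> K0 \<Longrightarrow> c t < 1/2" by (auto simp: eventually_sequentially)
  \<comment> \<open>The successor makes \<open>K\<close> positive, so that \<open>V\<close> contains
    the summand \<open>N x\<close> for \<open>t = 0\<close>.\<close>
  define K where "K = Suc K0"
  have cK: "c K \<le> 1/2" using K0[of K] by (simp add: K_def)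
  define V where "V x = (\<Sum>t<K. N ((A ^^ t) x))" for x
  \<comment> \<open>The added 1 gives \<open>M \<ge> 1\<close>, which later places
    \<open>\<theta>\<close> in \<open>[0, 1)\<close>.\<close>
  define M where "M = (\<Sum>t<K. c t) + 1"
  have c0: "c t \<ge> 0" for t by (simp add: c_def sum_nonneg)
  have M: "M > 0" using c0 by (simp add: M_def sum_nonneg add_nonneg_pos)
  have NV: "N x \<le> V x" for x
    unfolding V_def K_def by (simp add: sum.lessThan_Suc_shift N0 sum_nonneg del: sum.lessThan_Suc)
  have VN: "V x \<le> M * N x" if "\<And>k. k \<notin> I \<Longrightarrow> x k = 0" for x
  proof -
    have "V x \<le> (\<Sum>t<K. c t * N x)" unfolding V_def by (intro sum_mono bound that)
    also have "\<dots> = (\<Sum>t<K. c t) * N x" by (rule sum_distrib_right[symmetric])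
    finally show ?thesis using N0[of x] by (simp add: M_def algebra_simps)
  qed
  have V_add: "V (\<lambda>k. x k + y k) \<le> V x + V y" for x y
    unfolding V_def N_def funpow_add sum.distrib[symmetric]
    by (intro sum_mono L2_set_triangle_ineq)
  \<comment> \<open>Applying \<open>A\<close> shifts the sum by one: the summand \<open>N x\<close>
    leaves, and one of at most half its size enters.\<close>
  have VA: "V (A x) \<le> V x - N x / 2" if "\<And>k. k \<notin> I \<Longrightarrow> x k = 0" for x
  proof -
    have "V (A x) = (\<Sum>t<K. N ((A ^^ Suc t) x))"
      unfolding V_def by (simp add: funpow_swap1)
    also have "\<dots> = V x - N x + N ((A ^^ K) x)"
      using sum.lessThan_Suc_shift[of "\<lambda>t. N ((A ^^ t) x)" K] by (simp add: V_def)
    also have "N ((A ^^ K) x) \<le> 1/2 * N x"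
      using bound[of x K, OF that] mult_right_mono[OF cK N0[of x]] by linarith
    finally show ?thesis by simp
  qed

  \<comment> \<open>Contraction of the nonlinear map near the fixed point\<close>
  define z where "z x = (\<lambda>k. x k - p k)" for x
  have z0: "z x k = 0" if "x \<in> ?X" "k \<notin> I" for x k
    using PiE_arb[OF that] PiE_arb[OF p(1) that(2)] by (simp add: z_def)
  \<comment> \<open>\<open>V\<close> of the remainder is at most \<open>M\<close> times its norm, so
    the factor \<open>1 / (4 * M)\<close> lets it undo at most half of the decrease
    \<open>N (z x) / 2\<close> gained by \<open>A\<close>.\<close>
  obtain r where r: "r > 0" and rem:
    "\<And>x. x \<in> ?X \<Longrightarrow> N (z x) < r \<Longrightarrow> N (\<lambda>k. F x k - p k - A (z x) k) \<le> 1 / (4 * M) * N (z x)"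
  proof -
    have "1 / (4 * M) > 0" using M by simp
    from remainder[OF this] show ?thesis using that unfolding N_def z_def by blast
  qed
  \<comment> \<open>The net decrease \<open>N (z x) / 4\<close> is at least
    \<open>V (z x) / (4 * M)\<close>.\<close>
  define \<theta> where "\<theta> = 1 - 1 / (4 * M)"
  have "M \<ge> 1" using c0 by (simp add: M_def sum_nonneg)
  then have \<theta>: "0 \<le> \<theta>" "\<theta> < 1" by (simp_all add: \<theta>_def field_simps)
  have step: "V (z (F x)) \<le> \<theta> * V (z x)" if x: "x \<in> ?X" and small: "V (z x) < r" for x
  proof -
    let ?R = "\<lambda>k. F x k - p k - A (z x) k"
    have "N (z x) < r" using NV[of "z x"] small by simp
    then have R: "N ?R \<le> 1 / (4 * M) * N (z x)" by (rule rem[OF x])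
    have "?R k = 0" if "k \<notin> I" for k
      using z0[OF F[OF x] that] support[OF that] by (simp add: z_def)
    then have "V ?R \<le> M * N ?R" by (rule VN)
    also have "\<dots> \<le> M * (1 / (4 * M) * N (z x))" using R M by (intro mult_left_mono) auto
    finally have VR: "V ?R \<le> N (z x) / 4" using M by simp
    have "V (z (F x)) = V (\<lambda>k. A (z x) k + ?R k)" by (simp add: z_def)
    also have "\<dots> \<le> V (A (z x)) + V ?R" by (rule V_add)
    also have "\<dots> \<le> V (z x) - N (z x) / 4" using VA[of "z x", OF z0[OF x]] VR by simp
    also have "\<dots> \<le> \<theta> * V (z x)"
      using VN[of "z x", OF z0[OF x]] M by (simp add: \<theta>_def field_simps)
    finally show ?thesis .
  qed
  \<comment> \<open>The decay bound itself keeps the orbit in the region \<open>V < r\<close>, where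
    \<open>step\<close> applies again.\<close>
  have orbit: "(F ^^ t) x \<in> ?X \<and> V (z ((F ^^ t) x)) \<le> \<theta> ^ t * V (z x)"
    if x: "x \<in> ?X" and small: "V (z x) < r" for x t
  proof (induction t)
    case (Suc t)
    have "\<theta> ^ t * V (z x) \<le> 1 * V (z x)"
      using \<theta> NV[of "z x"] N0[of "z x"] by (intro mult_right_mono power_le_one) auto
    with Suc small have "V (z ((F ^^ t) x)) < r" by simp
    with Suc have "V (z (F ((F ^^ t) x))) \<le> \<theta> * V (z ((F ^^ t) x))" by (intro step) auto
    also have "\<dots> \<le> \<theta> * (\<theta> ^ t * V (z x))" using Suc \<theta> by (intro mult_left_mono) auto
    finally show ?case using Suc F by simp
  qed (use x in simp)
  \<comment> \<open>As \<open>V \<le> M * N\<close> on displacements, \<open>N (z x) < r / M\<close>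
    forces \<open>V (z x) < r\<close>.\<close>
  have decay: "N (z ((F ^^ t) x)) \<le> \<theta> ^ t * (M * N (z x))"
    if x: "x \<in> ?X" and small: "N (z x) < r / M" for x t
  proof -
    have V: "V (z x) \<le> M * N (z x)" by (rule VN[OF z0[OF x]])
    also have "\<dots> < r" using small M by (simp add: field_simps)
    finally have "V (z ((F ^^ t) x)) \<le> \<theta> ^ t * V (z x)" using orbit[OF x] by blast
    also have "\<dots> \<le> \<theta> ^ t * (M * N (z x))" using V \<theta> by (intro mult_left_mono) auto
    finally show ?thesis using NV order_trans by blast
  qed

  \<comment> \<open>Lyapunov stability and attraction\<close>
  have "lyapunov_stable ?X (\<lambda>x y. N (\<lambda>k. x k - y k)) F p"
    unfolding lyapunov_stable_def
  proof (intro allI impI)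
    fix e :: real assume e: "e > 0"
    have "N (z ((F ^^ t) x)) < e" if "x \<in> ?X" "N (z x) < min r e / M" for x t
    proof -
      have "N (z x) < r / M" and small: "M * N (z x) < e"
        using that(2) M by (auto simp: field_simps)
      then have "N (z ((F ^^ t) x)) \<le> \<theta> ^ t * (M * N (z x))" using decay that(1) by blast
      also have "\<dots> \<le> 1 * (M * N (z x))"
        using \<theta> M N0 by (intro mult_right_mono power_le_one) auto
      finally show ?thesis using small by simp
    qed
    then show "\<exists>r>0. \<forall>x\<in>?X. N (\<lambda>k. x k - p k) < r \<longrightarrow> (\<forall>t. N (\<lambda>k. (F ^^ t) x k - p k) < e)"
      using r e M unfolding z_def by (intro exI[of _ "min r e / M"]) auto
  qed
  moreover have "locally_attractive ?X (\<lambda>x y. N (\<lambda>k. x k - y k)) F p"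
    unfolding locally_attractive_def
  proof (intro exI[of _ "r / M"] conjI ballI impI)
    fix x assume x: "x \<in> ?X" "N (\<lambda>k. x k - p k) < r / M"
    have lim0: "(\<lambda>t. \<theta> ^ t * (M * N (z x))) \<longlonglongrightarrow> 0"
      using \<theta> by (intro tendsto_mult_left_zero LIMSEQ_realpow_zero)
    show "(\<lambda>t. N (\<lambda>k. (F ^^ t) x k - p k)) \<longlonglongrightarrow> 0"
      by (rule tendsto_sandwich[OF _ _ tendsto_const lim0])
        (use decay[OF x(1)] x(2) N0 in \<open>auto simp: z_def\<close>)
  qed (use r M in simp)
  ultimately show ?thesis
    unfolding asymptotically_stable_fixpoint_def N_def using p by blast
qed

end

section \<open>The characteristic equation\<close>

lemma norm_of_real_add_sq:
  "(norm (z + of_real a))\<^sup>2 = (norm z)\<^sup>2 + 2 * a * Re z + a\<^sup>2"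
  by (simp only: cmod_power2) (simp add: power2_eq_square algebra_simps)

text \<open>For fixed \<open>r = norm z\<close>, the squared product is a quadratic \<open>f\<close>
  in \<open>Re z\<close> with leading coefficient \<open>4 * a * e\<close>. If
  \<open>a \<ge> 0\<close>, both factors of \<open>f\<close> are nondecreasing and the minimum is at
  \<open>- r\<close>; if \<open>a < 0\<close>, \<open>f\<close> is concave and the minimum is at an
  endpoint. The endpoint values are squares of \<open>(r - a) * (r - e)\<close> and
  \<open>(r + a) * (r + e)\<close>, which are smallest at \<open>r = 1\<close>.\<close>

lemma norm_linear_factors_greater:
  fixes z :: complex and a e B :: real
  assumes r: "norm z \<ge> 1" and a: "-1 < a" "a < 1" and e: "0 \<le> e" "e < 1" and B: "0 \<le> B"
    and minus: "B < (1 - a) * (1 - e)" and plus: "B < (1 + a) * (1 + e)"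
  shows "B < norm (z + of_real a) * norm (z + of_real e)"
proof -
  define r where "r = norm z"
  define c where "c = Re z"
  have c: "- r \<le> c" "c \<le> r" using abs_Re_le_cmod[of z] by (auto simp: r_def c_def)
  have r1: "r \<ge> 1" using r by (simp add: r_def)
  define f where "f x = (r\<^sup>2 + 2 * a * x + a\<^sup>2) * (r\<^sup>2 + 2 * e * x + e\<^sup>2)" for x
  have "B < (r - a) * (r - e)"
    using minus mult_mono[of "1 - a" "r - a" "1 - e" "r - e"] r1 a e by auto
  then have "B\<^sup>2 < ((r - a) * (r - e))\<^sup>2" using B by (intro power_strict_mono) auto
  also have "\<dots> = f (- r)" by (simp add: f_def power2_eq_square algebra_simps)
  finally have f1: "B\<^sup>2 < f (- r)" .
  have "B < (r + a) * (r + e)"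
    using plus mult_mono[of "1 + a" "r + a" "1 + e" "r + e"] r1 a e by auto
  then have "B\<^sup>2 < ((r + a) * (r + e))\<^sup>2" using B by (intro power_strict_mono) auto
  also have "\<dots> = f r" by (simp add: f_def power2_eq_square algebra_simps)
  finally have f2: "B\<^sup>2 < f r" .
  have "B\<^sup>2 < f c"
  proof (cases "a \<ge> 0")
    case True
    have "f (- r) \<le> f c" unfolding f_def
    proof (rule mult_mono)
      show "r\<^sup>2 + 2 * a * - r + a\<^sup>2 \<le> r\<^sup>2 + 2 * a * c + a\<^sup>2"
        using mult_left_mono[OF c(1), of "2 * a"] True by simp
      show "r\<^sup>2 + 2 * e * - r + e\<^sup>2 \<le> r\<^sup>2 + 2 * e * c + e\<^sup>2"
        using mult_left_mono[OF c(1), of "2 * e"] e by simp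
      have "r\<^sup>2 + 2 * a * c + a\<^sup>2 = (norm (z + of_real a))\<^sup>2"
        by (simp add: norm_of_real_add_sq r_def c_def)
      then show "0 \<le> r\<^sup>2 + 2 * a * c + a\<^sup>2" by simp
      have "r\<^sup>2 + 2 * e * - r + e\<^sup>2 = (r - e)\<^sup>2" by (simp add: power2_eq_square algebra_simps)
      then show "0 \<le> r\<^sup>2 + 2 * e * - r + e\<^sup>2" by simp
    qed
    with f1 show ?thesis by simp
  next
    case False
    \<comment> \<open>\<open>f\<close> is then concave, so it lies above its chord over \<open>[- r, r]\<close>.\<close>
    have "2 * r * f c = (r + c) * f r + (r - c) * f (- r) + 8 * r * (- a * e) * ((r - c) * (r + c))"
      by (simp add: f_def power2_eq_square algebra_simps)
    moreover have "0 \<le> 8 * r * (- a * e) * ((r - c) * (r + c))"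
      using False e c r1 by (intro mult_nonneg_nonneg) auto
    moreover have "2 * r * B\<^sup>2 < (r + c) * f r + (r - c) * f (- r)"
    \<comment> \<open>At \<open>c = r\<close> the weight of \<open>f (- r)\<close> vanishes, so
      strictness has to come from \<open>f r\<close>.\<close>
    proof (cases "c = r")
      case True
      then show ?thesis using f2 r1 by simp
    next
      case False
      then have "(r - c) * B\<^sup>2 < (r - c) * f (- r)" using f1 c by simp
      moreover have "(r + c) * B\<^sup>2 \<le> (r + c) * f r" using f2 c by (intro mult_left_mono) auto
      ultimately show ?thesis by (simp add: algebra_simps)
    qed
    ultimately have "2 * r * B\<^sup>2 < 2 * r * f c" by linarith
    then show ?thesis using r1 by simp
  qed
  also have "f c = (norm (z + of_real a) * norm (z + of_real e))\<^sup>2"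
    by (simp add: f_def power_mult_distrib norm_of_real_add_sq r_def c_def)
  finally show ?thesis by (rule power_less_imp_less_base) simp
qed

text \<open>A characteristic root with \<open>norm z \<ge> 1\<close> would make the product of the
  two linear factors have norm at most \<open>B\<close>, because \<open>norm z ^ m \<ge> 1\<close>.
  The delay enters only through this inequality, so the criterion is uniform in
  \<open>m\<close>.\<close>

lemma delayed_second_order_recurrence_tendsto_0:
  fixes u :: "nat \<Rightarrow> real"
  assumes rec: "\<And>t. u (t + m + 2) + (a + e) * u (t + m + 1) + a * e * u (t + m) = B * u t"
    and a: "-1 < a" "a < 1" and e: "0 \<le> e" "e < 1" and B: "0 \<le> B"
    and minus: "B < (1 - a) * (1 - e)" and plus: "B < (1 + a) * (1 + e)"
  shows "u \<longlonglongrightarrow> 0"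
proof -
  define p :: "complex poly" where
    "p = [:of_real a, 1:] * ([:of_real e, 1:] * monom 1 m) + [:- of_real B:]"
  have "poly_shift p (\<lambda>t. of_real (u t)) = (\<lambda>_. 0)"
  proof
    fix t
    have "poly_shift p (\<lambda>t. of_real (u t)) t =
      complex_of_real (u (t + m + 2) + (a + e) * u (t + m + 1) + a * e * u (t + m) - B * u t)"
      unfolding p_def poly_shift_add poly_shift_linear_factor poly_shift_monom poly_shift_const
      by (simp add: algebra_simps)
    also have "\<dots> = of_real 0" by (simp only: rec[of t] diff_self)
    finally show "poly_shift p (\<lambda>t. of_real (u t)) t = 0" by simp
  qed
  then have shift: "poly_shift p (\<lambda>t. of_real (u t)) \<longlonglongrightarrow> 0" by simp
  have "norm z < 1" if "poly p z = 0" for z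
  proof (rule ccontr)
    assume "\<not> norm z < 1"
    then have z: "norm z \<ge> 1" by simp
    have "poly p z = (z + of_real a) * (z + of_real e) * z ^ m - of_real B"
      by (simp add: p_def poly_monom add.commute mult.assoc del: mult_pCons_left)
    then have "norm ((z + of_real a) * (z + of_real e) * z ^ m) = norm (complex_of_real B)"
      using that by simp
    then have "norm (z + of_real a) * norm (z + of_real e) * norm z ^ m = B"
      using B by (simp only: norm_mult norm_power norm_of_real abs_of_nonneg)
    moreover have "norm (z + of_real a) * norm (z + of_real e) * 1
        \<le> norm (z + of_real a) * norm (z + of_real e) * norm z ^ m"
      using z by (intro mult_left_mono one_le_power) auto
    ultimately show False using norm_linear_factors_greater[OF z a e B minus plus] by simp
  qed
  then have "(\<lambda>t. of_real (u t) :: complex) \<longlonglongrightarrow> 0"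
    using shift by (rule recurrence_tendsto_0)
  then have "(\<lambda>t. of_real (u t) :: complex) \<longlonglongrightarrow> of_real 0" by simp
  then show ?thesis by (simp only: tendsto_of_real_iff)
qed

section \<open>Linear delayed systems\<close>

text \<open>Unlike \<open>history_map\<close>, the value outside the index range is 0, as linearity
  on total functions requires.\<close>

definition linear_history_map ::
  "nat \<Rightarrow> nat \<Rightarrow> (history \<Rightarrow> nat \<Rightarrow> real) \<Rightarrow> history \<Rightarrow> history" where
  "linear_history_map n \<tau> L h = (\<lambda>(s, i).
     if s \<le> \<tau> \<and> i \<le> n then if s = 0 then L h i else h (s - 1, i) else 0)"

lemma linear_coordinate_map_history:
  assumes "\<And>x y i. L (\<lambda>k. x k + y k) i = L x i + L y i"
    and "\<And>c x i. L (\<lambda>k. c * x k) i = c * L x i"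
  shows "linear_coordinate_map ({..\<tau>} \<times> {..n}) (linear_history_map n \<tau> L)"
  by unfold_locales (auto simp: linear_history_map_def assms split: if_splits)

text \<open>A history only transports its entries, so a delayed coordinate is an earlier newest
  value; decay then needs checking only at delay 0.\<close>

lemma linear_history_map_shift:
  assumes "i \<le> n" "s \<le> \<tau>"
  shows "(linear_history_map n \<tau> L ^^ (t + s)) h (s, i) = (linear_history_map n \<tau> L ^^ t) h (0, i)"
  using assms(2)
proof (induction s)
  case (Suc s)
  then show ?case using assms(1) by (simp add: linear_history_map_def)
qed simp

lemma linear_history_map_tendsto_0:
  assumes lim: "\<And>i. i \<le> n \<Longrightarrow> (\<lambda>t. (linear_history_map n \<tau> L ^^ t) h (0, i)) \<longlonglongrightarrow> 0"
    and k: "k \<in> {..\<tau>} \<times> {..n}"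
  shows "(\<lambda>t. (linear_history_map n \<tau> L ^^ t) h k) \<longlonglongrightarrow> 0"
proof -
  from k obtain s i where si: "k = (s, i)" "s \<in> {..\<tau>}" "i \<in> {..n}" by (rule SigmaE)
  then have "(\<lambda>t. (linear_history_map n \<tau> L ^^ (t + s)) h k) \<longlonglongrightarrow> 0"
    using lim[of i] by (simp only: linear_history_map_shift atMost_iff)
  then show ?thesis by (rule LIMSEQ_offset)
qed

section \<open>The linearized oligopoly\<close>

text \<open>The derivative of \<open>oligopoly_step\<close> at the positive equilibrium for
  \<open>\<tau>2 = 0\<close>, with \<open>\<alpha> * b * q0s\<close> written as
  \<open>1 + \<epsilon>1\<close>.\<close>

definition linearized_step ::
  "nat \<Rightarrow> real \<Rightarrow> real \<Rightarrow> nat \<Rightarrow> nat \<Rightarrow> history \<Rightarrow> nat \<Rightarrow> real" where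
  "linearized_step n \<delta> \<epsilon>1 \<tau>0 \<tau>1 h j =
    (if j = 0 then - \<epsilon>1 * h (0, 0) - \<delta> * (1 + \<epsilon>1) * (\<Sum>i = 1..n. h (\<tau>1, i))
     else - \<delta> / 2 * h (\<tau>0, 0) - \<delta> / 2 * (\<Sum>i \<in> {1..n} - {j}. h (0, i)))"

lemma linear_coordinate_map_linearized_step:
  "linear_coordinate_map ({..\<tau>} \<times> {..n})
    (linear_history_map n \<tau> (linearized_step n \<delta> \<epsilon>1 \<tau>0 \<tau>1))"
  by (rule linear_coordinate_map_history)
    (simp_all add: linearized_step_def sum.distrib sum_distrib_left algebra_simps)

text \<open>The system is triangular after summation: \<open>u\<close> satisfies a scalar recurrence
  of its own, \<open>S\<close> is driven by \<open>u\<close> with multiplier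
  \<open>- \<epsilon>2\<close>, and each remaining component is driven by \<open>u\<close> and
  \<open>S\<close> with multiplier \<open>\<delta> / 2\<close>.\<close>

lemma linearized_orbit_tendsto_0:
  fixes n \<tau>0 \<tau>1 \<tau> :: nat and \<delta> \<epsilon>0 \<epsilon>1 \<epsilon>2 :: real
  assumes n: "n \<ge> 1" and \<tau>: "\<tau>0 \<le> \<tau>" "\<tau>1 \<le> \<tau>" and \<delta>: "0 < \<delta>" "\<delta> < 1"
    and \<epsilon>0: "\<epsilon>0 = real n * \<delta>\<^sup>2 / 2" and \<epsilon>2: "\<epsilon>2 = (real n - 1) * \<delta> / 2" "\<epsilon>2 < 1"
    and \<epsilon>1: "-1 < \<epsilon>1" "\<epsilon>1 < 1"
    and minus: "(1 + \<epsilon>1) * \<epsilon>0 < (1 - \<epsilon>1) * (1 - \<epsilon>2)" and plus: "\<epsilon>0 < 1 + \<epsilon>2"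
    and k: "k \<in> {..\<tau>} \<times> {..n}"
  shows "(\<lambda>t. (linear_history_map n \<tau> (linearized_step n \<delta> \<epsilon>1 \<tau>0 \<tau>1) ^^ t) h k) \<longlonglongrightarrow> 0"
proof (rule linear_history_map_tendsto_0[OF _ k])
  define y where "y t = (linear_history_map n \<tau> (linearized_step n \<delta> \<epsilon>1 \<tau>0 \<tau>1) ^^ t) h" for t
  define S where "S t = (\<Sum>i = 1..n. y t (0, i))" for t
  define u where "u t = y t (0, 0)" for t
  have shift: "y (t + s) (s, i) = y t (0, i)" if "i \<le> n" "s \<le> \<tau>" for t s i
    unfolding y_def using that by (rule linear_history_map_shift)
  have step: "y (Suc t) (0, i) = linearized_step n \<delta> \<epsilon>1 \<tau>0 \<tau>1 (y t) i" if "i \<le> n" for t i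
    using that by (simp add: y_def linear_history_map_def)
  \<comment> \<open>Time is advanced by the delay so that the delayed entries become newest values
    at time \<open>t\<close>, with no reference to the initial history; \<open>S_step\<close> does
    the same with \<open>\<tau>0\<close>.\<close>
  have u_step: "u (Suc (t + \<tau>1)) = - \<epsilon>1 * u (t + \<tau>1) - \<delta> * (1 + \<epsilon>1) * S t" for t
    using \<tau> by (simp add: u_def step linearized_step_def S_def shift)
  have yj: "y (Suc t) (0, j) = - \<delta> / 2 * y t (\<tau>0, 0) - \<delta> / 2 * (S t - y t (0, j))"
    if "j \<in> {1..n}" for t j
    using that by (simp add: step linearized_step_def S_def sum_diff1)
  have S_step': "S (Suc t) = - real n * \<delta> / 2 * y t (\<tau>0, 0) - \<epsilon>2 * S t" for t
  proof -
    have "S (Suc t) = (\<Sum>j = 1..n. - \<delta> / 2 * y t (\<tau>0, 0) - \<delta> / 2 * (S t - y t (0, j)))"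
      unfolding S_def[of "Suc t"] by (intro sum.cong refl yj)
    also have "\<dots> = - real n * (\<delta> / 2) * y t (\<tau>0, 0) - \<delta> / 2 * (real n * S t - S t)"
      by (simp only: sum_subtractf sum_distrib_left[symmetric] S_def[symmetric]) simp
    finally show ?thesis by (simp add: \<epsilon>2(1) field_simps)
  qed
  have S_step: "S (Suc (t + \<tau>0)) = - real n * \<delta> / 2 * u t - \<epsilon>2 * S (t + \<tau>0)" for t
    using S_step'[of "t + \<tau>0"] \<tau> by (simp add: shift u_def)
  have \<epsilon>0': "\<epsilon>0 > 0" using n \<delta> by (simp add: \<epsilon>0)
  have \<epsilon>2': "\<epsilon>2 \<ge> 0" using n \<delta> by (simp add: \<epsilon>2)
  have u: "u \<longlonglongrightarrow> 0"
  proof (rule delayed_second_order_recurrence_tendsto_0[where m = "\<tau>0 + \<tau>1"])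
    show "u (t + (\<tau>0 + \<tau>1) + 2) + (\<epsilon>1 + \<epsilon>2) * u (t + (\<tau>0 + \<tau>1) + 1)
        + \<epsilon>1 * \<epsilon>2 * u (t + (\<tau>0 + \<tau>1)) = (1 + \<epsilon>1) * \<epsilon>0 * u t" for t
    proof -
      define T where "T = t + (\<tau>0 + \<tau>1)"
      have 1: "u (Suc T) = - \<epsilon>1 * u T - \<delta> * (1 + \<epsilon>1) * S (t + \<tau>0)"
        using u_step[of "t + \<tau>0"] by (simp add: T_def ac_simps)
      have 2: "u (Suc (Suc T)) = - \<epsilon>1 * u (Suc T) - \<delta> * (1 + \<epsilon>1) * S (Suc (t + \<tau>0))"
        using u_step[of "Suc (t + \<tau>0)"] by (simp add: T_def ac_simps)
      \<comment> \<open>Adding \<open>\<epsilon>2\<close> times equation \<open>1\<close> to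
        equation \<open>2\<close> produces exactly the combination of \<open>S\<close> that
        \<open>S_step\<close> expresses through \<open>u\<close>.\<close>
      have "u (Suc (Suc T)) + (\<epsilon>1 + \<epsilon>2) * u (Suc T) + \<epsilon>1 * \<epsilon>2 * u T
          = (u (Suc (Suc T)) + \<epsilon>1 * u (Suc T)) + \<epsilon>2 * (u (Suc T) + \<epsilon>1 * u T)"
        by (simp add: algebra_simps)
      also have "\<dots> = - \<delta> * (1 + \<epsilon>1) * (S (Suc (t + \<tau>0)) + \<epsilon>2 * S (t + \<tau>0))"
        unfolding 2 1 by (simp add: algebra_simps)
      also have "\<dots> = (1 + \<epsilon>1) * \<epsilon>0 * u t"
        unfolding S_step by (simp add: \<epsilon>0 power2_eq_square)
      finally show ?thesis by (simp add: T_def)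
    qed
    show "(1 + \<epsilon>1) * \<epsilon>0 < (1 + \<epsilon>1) * (1 + \<epsilon>2)" using plus \<epsilon>1 by simp
  qed (use \<epsilon>1 \<epsilon>2 \<epsilon>2' \<epsilon>0' minus in auto)
  have S: "S \<longlonglongrightarrow> 0"
  proof -
    have "(\<lambda>t. S (t + \<tau>0)) \<longlonglongrightarrow> 0"
    proof (rule first_order_recurrence_tendsto_0[where c = "- \<epsilon>2"])
      show "(\<lambda>t. S (Suc t + \<tau>0) - - \<epsilon>2 * S (t + \<tau>0)) \<longlonglongrightarrow> 0"
        using tendsto_mult_right_zero[OF u, of "- real n * \<delta> / 2"] by (simp add: S_step)
    qed (use \<epsilon>2 \<epsilon>2' in simp)
    then show ?thesis by (rule LIMSEQ_offset)
  qed
  fix i assume i: "i \<le> n"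
  have "(\<lambda>t. y t (0, i)) \<longlonglongrightarrow> 0"
  proof (cases "i = 0")
    case True
    then show ?thesis using u by (simp add: u_def[abs_def])
  next
    case False
    with i have i: "i \<in> {1..n}" by simp
    have "(\<lambda>t. y (t + \<tau>0) (0, i)) \<longlonglongrightarrow> 0"
    proof (rule first_order_recurrence_tendsto_0[where c = "\<delta> / 2"])
      have "(\<lambda>t. - \<delta> / 2 * (u t + S (t + \<tau>0))) \<longlonglongrightarrow> 0"
        using tendsto_mult_right_zero[OF tendsto_add_zero[OF u LIMSEQ_ignore_initial_segment[OF S]]] .
      moreover have "y (Suc t + \<tau>0) (0, i) - \<delta> / 2 * y (t + \<tau>0) (0, i)
          = - \<delta> / 2 * (u t + S (t + \<tau>0))" for t
      proof -
        have "y (t + \<tau>0) (\<tau>0, 0) = u t" using \<tau> by (simp add: shift u_def)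
        then show ?thesis
          unfolding add_Suc yj[OF i, of "t + \<tau>0"] by (simp add: algebra_simps)
      qed
      ultimately show "(\<lambda>t. y (Suc t + \<tau>0) (0, i) - \<delta> / 2 * y (t + \<tau>0) (0, i)) \<longlonglongrightarrow> 0"
        by simp
    qed (use \<delta> in simp)
    then show ?thesis by (rule LIMSEQ_offset)
  qed
  then show "(\<lambda>t. (linear_history_map n \<tau> (linearized_step n \<delta> \<epsilon>1 \<tau>0 \<tau>1) ^^ t) h (0, i)) \<longlonglongrightarrow> 0"
    by (simp add: y_def)
qed

text \<open>The equilibrium equations cancel the constant terms. The only nonlinearity is the
  product in the equation of component 0, so the remainder is an exact quadratic form there and 0 in
  the affine equations. \<open>z\<close> is prescribed only at the entries that the steps
  read.\<close>

lemma oligopoly_step_expansion: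
  fixes n \<tau>0 \<tau>1 :: nat and \<alpha> b \<delta> a0 a1 q0s q1s :: real and x :: history
  assumes equilibrium: "a0 = b * q0s + b * \<delta> * (real n * q1s)"
    "q1s = a1 / (2 * b) - \<delta> / 2 * q0s - \<delta> / 2 * ((real n - 1) * q1s)"
    and j: "j \<le> n"
    and z0: "z (0, 0) = x (0, 0) - q0s" "z (\<tau>0, 0) = x (\<tau>0, 0) - q0s"
    and z1: "\<And>i. i \<in> {1..n} \<Longrightarrow> z (\<tau>1, i) = x (\<tau>1, i) - q1s"
      "\<And>i. i \<in> {1..n} \<Longrightarrow> z (0, i) = x (0, i) - q1s"
  shows "oligopoly_step n \<alpha> b \<delta> a0 a1 \<tau>0 \<tau>1 0 x j - (if j = 0 then q0s else q1s)
      - linearized_step n \<delta> (\<alpha> * b * q0s - 1) \<tau>0 \<tau>1 z j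
    = (if j = 0 then - (\<alpha> * b * z (0, 0) * (z (0, 0) + \<delta> * (\<Sum>i = 1..n. z (\<tau>1, i)))) else 0)"
proof (cases "j = 0")
  case True
  have "(\<Sum>i = 1..n. x (\<tau>1, i)) = real n * q1s + (\<Sum>i = 1..n. z (\<tau>1, i))"
    by (simp add: z1 sum_subtractf)
  moreover have "x (0, 0) = q0s + z (0, 0)" by (simp add: z0)
  ultimately show ?thesis
    using True by (simp add: oligopoly_step_def linearized_step_def equilibrium(1) algebra_simps)
next
  case False
  with j have "j \<in> {1..n}" by simp
  then have sum: "(\<Sum>i \<in> {1..n} - {j}. x (0, i)) = (\<Sum>i \<in> {1..n} - {j}. z (0, i)) + (real n - 1) * q1s"
    by (simp add: z1 sum_subtractf of_nat_diff)
  have x0: "x (\<tau>0, 0) = z (\<tau>0, 0) + q0s" using z0(2) by simp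
  show ?thesis
    using False equilibrium(2) unfolding oligopoly_step_def linearized_step_def sum x0
    by (simp only: if_False distrib_left)
qed

section \<open>Stability of the positive equilibrium\<close>

theorem theorem3:
  fixes n \<tau>0 \<tau>1 \<tau>2 :: nat
    and \<alpha> b \<delta> a0 a1 q0s q1s \<epsilon>0 \<epsilon>1 \<epsilon>2 :: real
  assumes "n \<ge> 1" and "\<alpha> > 0" and "b > 0" and "0 < \<delta>" and "\<delta> < 1"
    and "0 < a0" and "a0 \<le> a1"
    and "\<tau>2 = 0"
    and "(2 + (real n - 1) * \<delta>) * a0 > real n * \<delta> * a1"
    and "a1 > \<delta> * a0"
    and "q0s = ((2 + (real n - 1) * \<delta>) * a0 - real n * \<delta> * a1)
               / (b * (2 + (real n - 1) * \<delta> - real n * \<delta>\<^sup>2))"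
    and "q1s = (a1 - \<delta> * a0) / (b * (2 + (real n - 1) * \<delta> - real n * \<delta>\<^sup>2))"
    and "\<epsilon>0 = real n * \<delta>\<^sup>2 / 2"
    and "\<epsilon>1 = \<alpha> * (((2 + (real n - 1) * \<delta>) * a0 - real n * \<delta> * a1)
                    / (2 + (real n - 1) * \<delta> - real n * \<delta>\<^sup>2)) - 1"
    and "\<epsilon>2 = (real n - 1) * \<delta> / 2"
    and "\<epsilon>2 < 1"
    and "\<epsilon>1 < (1 - \<epsilon>2 - \<epsilon>0) / (1 - \<epsilon>2 + \<epsilon>0)"
  shows "asymptotically_stable_equilibrium n (Max {\<tau>0, \<tau>1, \<tau>2})
           (oligopoly_step n \<alpha> b \<delta> a0 a1 \<tau>0 \<tau>1 \<tau>2)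
           (\<lambda>i. if i = 0 then q0s else q1s)"
proof -
  define D where "D = 2 + (real n - 1) * \<delta> - real n * \<delta>\<^sup>2"
  define \<tau> where "\<tau> = Max {\<tau>0, \<tau>1, \<tau>2}"
  define I where "I = {..\<tau>} \<times> {..n}"
  define E where "E = (\<lambda>i :: nat. if i = 0 then q0s else q1s)"
  define F where "F = history_map n \<tau> (oligopoly_step n \<alpha> b \<delta> a0 a1 \<tau>0 \<tau>1 \<tau>2)"
  define p where "p = constant_history n \<tau> E"
  define A where "A = linear_history_map n \<tau> (linearized_step n \<delta> \<epsilon>1 \<tau>0 \<tau>1)"
  note n = assms(1) and \<alpha> = assms(2) and b = assms(3) and \<delta> = assms(4,5)
  have \<tau>: "\<tau>0 \<le> \<tau>" "\<tau>1 \<le> \<tau>" by (simp_all add: \<tau>_def)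

  \<comment> \<open>Consequences of the parameter hypotheses\<close>
  have D: "D > 0"
  proof -
    have "D = (real n - 1) * (\<delta> * (1 - \<delta>)) + (2 - \<delta>\<^sup>2)"
      by (simp add: D_def power2_eq_square algebra_simps)
    moreover have "(real n - 1) * (\<delta> * (1 - \<delta>)) \<ge> 0" using n \<delta> by simp
    moreover have "\<delta>\<^sup>2 < 1" using \<delta> by (simp add: power_less_one_iff)
    ultimately show ?thesis by linarith
  qed
  have q0s: "b * q0s * D = (2 + (real n - 1) * \<delta>) * a0 - real n * \<delta> * a1"
    using b D assms(11) by (simp add: D_def)
  have q1s: "b * q1s * D = a1 - \<delta> * a0"
    using b D assms(12) by (simp add: D_def)
  have \<epsilon>1_eq: "\<epsilon>1 = \<alpha> * b * q0s - 1"
    using b D assms(11,14) by (simp add: D_def)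
  have "b * q0s * D > 0" using q0s assms(9) by simp
  then have "q0s > 0" using b D by (simp add: zero_less_mult_iff)
  then have \<epsilon>1_gt: "- 1 < \<epsilon>1" using \<alpha> b by (simp add: \<epsilon>1_eq)
  \<comment> \<open>The first equation says that the bracket in the step of component 0 vanishes.
    Multiplied by \<open>D\<close>, both equations become polynomial identities in the
    parameters.\<close>
  have equilibrium: "a0 = b * q0s + b * \<delta> * (real n * q1s)"
    "q1s = a1 / (2 * b) - \<delta> / 2 * q0s - \<delta> / 2 * ((real n - 1) * q1s)"
  proof -
    have "(b * q0s + b * \<delta> * (real n * q1s)) * D = b * q0s * D + \<delta> * real n * (b * q1s * D)"
      by (simp add: algebra_simps)
    also have "\<dots> = a0 * D"
      unfolding q0s q1s by (simp add: D_def power2_eq_square algebra_simps)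
    finally show "a0 = b * q0s + b * \<delta> * (real n * q1s)" using D by simp
    have "(b * \<delta> * q0s + (2 + (real n - 1) * \<delta>) * (b * q1s)) * D
        = \<delta> * (b * q0s * D) + (2 + (real n - 1) * \<delta>) * (b * q1s * D)"
      by (simp add: algebra_simps)
    also have "\<dots> = a1 * D"
      unfolding q0s q1s by (simp add: D_def power2_eq_square algebra_simps)
    finally have "a1 = b * \<delta> * q0s + (2 + (real n - 1) * \<delta>) * (b * q1s)" using D by simp
    then show "q1s = a1 / (2 * b) - \<delta> / 2 * q0s - \<delta> / 2 * ((real n - 1) * q1s)"
      using b by (simp add: field_simps)
  qed
  have \<epsilon>0: "\<epsilon>0 > 0" using n \<delta> by (simp add: assms(13))
  have den: "1 - \<epsilon>2 + \<epsilon>0 > 0" using \<epsilon>0 assms(16) by simp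
  have "(1 - \<epsilon>2 - \<epsilon>0) / (1 - \<epsilon>2 + \<epsilon>0) < 1" using den \<epsilon>0 by (simp add: divide_less_eq)
  with assms(17) have \<epsilon>1_lt: "\<epsilon>1 < 1" by simp
  have "\<epsilon>1 * (1 - \<epsilon>2 + \<epsilon>0) < 1 - \<epsilon>2 - \<epsilon>0" using assms(17) den by (simp add: less_divide_eq)
  \<comment> \<open>This is the bound on \<open>\<epsilon>1\<close> with its denominator cleared; it
    compares the two sides of the characteristic equation at \<open>z = -1\<close>.\<close>
  then have minus: "(1 + \<epsilon>1) * \<epsilon>0 < (1 - \<epsilon>1) * (1 - \<epsilon>2)" by (simp add: algebra_simps)
  \<comment> \<open>Here \<open>1 + \<epsilon>2 - \<epsilon>0 = D / 2\<close>; multiplied by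
    \<open>1 + \<epsilon>1\<close>, this is the comparison at \<open>z = 1\<close>.\<close>
  have plus: "\<epsilon>0 < 1 + \<epsilon>2" using D by (simp add: assms(13,15) D_def field_simps)

  \<comment> \<open>Applying the linearization theorem\<close>
  interpret linear_coordinate_map I A
    unfolding I_def A_def by (rule linear_coordinate_map_linearized_step)
  have "asymptotically_stable_fixpoint (I \<rightarrow>\<^sub>E UNIV) (\<lambda>x y. L2_set (\<lambda>k. x k - y k) I) F p"
  proof (rule asymptotically_stable_by_linearization)
    show p: "p \<in> I \<rightarrow>\<^sub>E UNIV" by (auto simp: p_def I_def constant_history_def)
    show F: "F x \<in> I \<rightarrow>\<^sub>E UNIV" for x by (auto simp: F_def I_def history_map_def)
    show "(\<lambda>t. (A ^^ t) x k) \<longlonglongrightarrow> 0" if "k \<in> I" for x k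
      unfolding A_def
      using linearized_orbit_tendsto_0[OF n \<tau> \<delta> assms(13,15,16) \<epsilon>1_gt \<epsilon>1_lt minus plus] that
      by (simp add: I_def)
    \<comment> \<open>Entries with positive delay are merely shifted, identically in
      \<open>F\<close> and \<open>A\<close>, so the remainder sits in the single coordinate
      \<open>(0, 0)\<close>.\<close>
    have expansion: "F x k - p k - A (\<lambda>k. x k - p k) k =
        (if k = (0, 0) then - (\<alpha> * b * (x (0, 0) - p (0, 0)) *
            (x (0, 0) - p (0, 0) + \<delta> * (\<Sum>i = 1..n. x (\<tau>1, i) - p (\<tau>1, i)))) else 0)"
      if k: "k \<in> I" for x k
    proof -
      from k[unfolded I_def] obtain s i
        where k_eq: "k = (s, i)" and mem: "s \<in> {..\<tau>}" "i \<in> {..n}" by (rule SigmaE)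
      note si = k_eq mem[unfolded atMost_iff]
      have pk: "p (s, i) = E i" if "s \<le> \<tau>" "i \<le> n" for s i
        using that by (simp add: p_def constant_history_def)
      show ?thesis
      proof (cases "s = 0")
        case True
        have "oligopoly_step n \<alpha> b \<delta> a0 a1 \<tau>0 \<tau>1 0 x i - (if i = 0 then q0s else q1s)
            - linearized_step n \<delta> (\<alpha> * b * q0s - 1) \<tau>0 \<tau>1 (\<lambda>k. x k - p k) i
          = (if i = 0 then - (\<alpha> * b * (x (0, 0) - p (0, 0)) * (x (0, 0) - p (0, 0)
              + \<delta> * (\<Sum>i = 1..n. x (\<tau>1, i) - p (\<tau>1, i)))) else 0)"
          by (rule oligopoly_step_expansion[OF equilibrium si(3)]) (use \<tau> in \<open>auto simp: pk E_def\<close>)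
        then show ?thesis
          using True si pk[of 0 i]
          by (simp add: F_def A_def history_map_def linear_history_map_def \<epsilon>1_eq assms(8) E_def)
      next
        case False
        then show ?thesis
          using si pk[of s i] pk[of "s - 1" i]
          by (simp add: F_def A_def history_map_def linear_history_map_def)
      qed
    qed
    \<comment> \<open>At \<open>x = p\<close> the displacement is 0, where both \<open>A\<close> and
      the quadratic remainder vanish; outside \<open>I\<close> both sides take the default
      value.\<close>
    show "F p = p"
    proof
      fix k
      have "A (\<lambda>_. 0) = (\<lambda>_. 0)" using scale[of 0 "\<lambda>_. 0"] by simp
      then have "F p k - p k = 0" if "k \<in> I"
        using expansion[OF that, of p] by (simp only: diff_self if_cancel mult_zero_left mult_zero_right minus_zero diff_zero)
      then show "F p k = p k"
        using PiE_arb[OF F, of k p] PiE_arb[OF p, of k] by (cases "k \<in> I") simp_all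
    qed
    fix \<eta> :: real assume \<eta>: "\<eta> > 0"
    \<comment> \<open>With \<open>?N\<close> the norm of the displacement, the two factors of the
      remainder are at most \<open>?N\<close> and \<open>(1 + \<delta> * real n) * ?N\<close>. The
      radius \<open>\<eta> / C\<close> then turns \<open>C * ?N\<^sup>2\<close> into at most
      \<open>\<eta> * ?N\<close>.\<close>
    define C where "C = \<alpha> * b * (1 + \<delta> * real n)"
    have C: "C > 0" using \<alpha> b \<delta> by (simp add: C_def add_pos_nonneg)
    have quadratic: "L2_set (\<lambda>k. F x k - p k - A (\<lambda>k. x k - p k) k) I
        \<le> C * (L2_set (\<lambda>k. x k - p k) I)\<^sup>2" for x
    proof -
      let ?N = "L2_set (\<lambda>k. x k - p k) I"
      have coord: "\<bar>x k - p k\<bar> \<le> ?N" if "k \<in> I" for k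
      proof -
        have "\<bar>x k - p k\<bar> \<le> L2_set (\<lambda>k. \<bar>x k - p k\<bar>) I"
          using that finite_index by (rule member_le_L2_set[rotated])
        then show ?thesis by (simp add: L2_set_def)
      qed
      let ?z = "x (0, 0) - p (0, 0)" and ?S = "\<Sum>i = 1..n. x (\<tau>1, i) - p (\<tau>1, i)"
      have mem_I: "(s, i) \<in> I \<longleftrightarrow> s \<le> \<tau> \<and> i \<le> n" for s i by (simp add: I_def)
      then have I0: "(0, 0) \<in> I" by simp
      have z: "\<bar>?z\<bar> \<le> ?N" using coord[OF I0] .
      have "\<bar>?S\<bar> \<le> (\<Sum>i = 1..n. ?N)"
        by (rule order_trans[OF sum_abs sum_mono]) (use \<tau> in \<open>auto intro!: coord simp: mem_I\<close>)
      then have S: "\<delta> * \<bar>?S\<bar> \<le> \<delta> * (real n * ?N)" using \<delta> by (intro mult_left_mono) auto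
      then have zS: "\<bar>?z + \<delta> * ?S\<bar> \<le> (1 + \<delta> * real n) * ?N"
      proof -
        have "\<bar>?z + \<delta> * ?S\<bar> \<le> \<bar>?z\<bar> + \<delta> * \<bar>?S\<bar>"
          using \<delta> abs_triangle_ineq[of ?z "\<delta> * ?S"] by (simp add: abs_mult)
        also have "\<dots> \<le> ?N + \<delta> * (real n * ?N)" using z S by (rule add_mono)
        finally show ?thesis by (simp add: algebra_simps)
      qed
      have "L2_set (\<lambda>k. F x k - p k - A (\<lambda>k. x k - p k) k) I
          \<le> (\<Sum>k\<in>I. \<bar>F x k - p k - A (\<lambda>k. x k - p k) k\<bar>)"
        by (rule L2_set_le_sum_abs)
      also have "\<dots> = (\<Sum>k\<in>I. if k = (0, 0) then \<bar>\<alpha> * b * ?z * (?z + \<delta> * ?S)\<bar> else 0)"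
        by (intro sum.cong refl) (auto simp: expansion)
      also have "\<dots> = \<alpha> * b * (\<bar>?z\<bar> * \<bar>?z + \<delta> * ?S\<bar>)"
        using I0 finite_index \<alpha> b by (simp add: abs_mult)
      also have "\<dots> \<le> \<alpha> * b * (?N * ((1 + \<delta> * real n) * ?N))"
        using z zS \<alpha> b by (intro mult_left_mono mult_mono) auto
      finally show ?thesis by (simp add: C_def power2_eq_square ac_simps)
    qed
    have "L2_set (\<lambda>k. F x k - p k - A (\<lambda>k. x k - p k) k) I \<le> \<eta> * L2_set (\<lambda>k. x k - p k) I"
      if "L2_set (\<lambda>k. x k - p k) I < \<eta> / C" for x
    proof -
      let ?N = "L2_set (\<lambda>k. x k - p k) I"
      have "C * ?N \<le> \<eta>" using that C by (simp add: field_simps)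
      then have "C * ?N * ?N \<le> \<eta> * ?N" by (intro mult_right_mono) auto
      with quadratic[of x] show ?thesis by (simp add: power2_eq_square mult.assoc)
    qed
    then show "\<exists>r>0. \<forall>x \<in> I \<rightarrow>\<^sub>E UNIV. L2_set (\<lambda>k. x k - p k) I < r \<longrightarrow>
        L2_set (\<lambda>k. F x k - p k - A (\<lambda>k. x k - p k) k) I \<le> \<eta> * L2_set (\<lambda>k. x k - p k) I"
      using \<eta> C by (intro exI[of _ "\<eta> / C"]) simp
  qed
  moreover have "history_dist n \<tau> = (\<lambda>x y. L2_set (\<lambda>k. x k - y k) I)"
    by (simp add: history_dist_def I_def fun_eq_iff)
  ultimately show ?thesis
    unfolding asymptotically_stable_equilibrium_def histories_def
    by (simp only: F_def p_def I_def \<tau>_def E_def)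
qed

end
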